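(* Let $M\in\mathbb{R}_+^{m\times n}$ be a matrix with nonnegative real entries, and let $r$ be a positive integer. Then the following holds: (i) If there is a one-way quantum protocol with $r$-dimensional messages that computes $M$ in expectation, then $M$ has a rank-$r$ PSD factorization. (ii) If $M$ has a rank-$r$ PSD factorization, then there is a one-way quantum protocol with $(r+1)$-dimensional messages that computes $M$ in expectation.
   Context: All matrices are real; PSD means symmetric positive semidefinite. A rank-$r$ PSD factorization of an $m\times n$ matrix $M$ is a collection of $r\times r$ PSD matrices $T_1,\ldots,T_m$ and $U^1,\ldots,U^n$ such that $\operatorname{Tr}[T_iU^j]=M_{ij}$ for all $i\in\{1,\ldots,m\}$, $j\in\{1,\ldots,n\}$. An $r$-dimensional quantum state is an $r\times r$ PSD matrix $\rho$ of trace $1$. A POVM (in dimension $r$) is a finite family $\{E_\theta\}_{\theta\in\Theta}$ of $r\times r$ PSD matrices, labeled by distinct real numbers $\theta$, with $\sum_{\theta\in\Theta}E_\theta=I$. Measuring state $\rho$ with this POVM yields outcome $\theta$ with probability $\operatorname{Tr}[E_\theta\rho]$, so the expected outcome is $\sum_{\theta\in\Theta}\theta\operatorname{Tr}[E_\theta\rho]$. A one-way quantum protocol with $r$-dimensional messages (for row inputs $i\in\{1,\dots,m\}$ and column inputs $j\in\{1,\dots,n\}$) consists of an $r$-dimensional state $\rho_i$ for each $i$ (sent by Alice on input $i$) and, for each $j$, a POVM $\{E^j_\theta\}$ in dimension $r$ whose labels $\theta$ are all nonnegative (with which Bob, on input $j$, measures the state received, outputting the outcome). The protocol computes $M$ in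 expectation if for all $i,j$ the expected value of the output on inputs $i,j$, namely $\sum_\theta\theta\operatorname{Tr}[E^j_\theta\rho_i]$, equals $M_{ij}$. *)

theory Defs
  imports Complex_Main "Jordan_Normal_Form.Matrix"
begin

text \<open>Row and column inputs are numbered from 0, as are the entries of a matrix:
  families over \<open>{1,...,m}\<close> become functions on \<open>nat\<close> that matter only below \<open>m\<close>.\<close>

definition psd :: "nat \<Rightarrow> real mat \<Rightarrow> bool" where
  "psd r A \<longleftrightarrow> A \<in> carrier_mat r r \<and> transpose_mat A = A \<and>
     (\<forall>x \<in> carrier_vec r. x \<bullet> (A *\<^sub>v x) \<ge> 0)"

definition mat_trace :: "real mat \<Rightarrow> real" where
  "mat_trace A = (\<Sum>i<dim_row A. A $$ (i, i))"

definition psd_factorization ::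
    "nat \<Rightarrow> nat \<Rightarrow> nat \<Rightarrow> real mat \<Rightarrow> (nat \<Rightarrow> real mat) \<Rightarrow> (nat \<Rightarrow> real mat) \<Rightarrow> bool" where
  "psd_factorization m n r M T U \<longleftrightarrow>
     (\<forall>i<m. psd r (T i)) \<and> (\<forall>j<n. psd r (U j)) \<and>
     (\<forall>i<m. \<forall>j<n. mat_trace (T i * U j) = M $$ (i, j))"

definition quantum_state :: "nat \<Rightarrow> real mat \<Rightarrow> bool" where
  "quantum_state r \<rho> \<longleftrightarrow> psd r \<rho> \<and> mat_trace \<rho> = 1"

text \<open>A POVM is given by its finite set \<open>\<Theta>\<close> of labels, which are thereby distinct, and
  the matrix \<open>E \<theta>\<close> for each label \<open>\<theta> \<in> \<Theta>\<close>; values of \<open>E\<close> outside \<open>\<Theta>\<close> are irrelevant.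
  Since \<open>real mat\<close> has no global zero matrix, the matrices are added up
  in the module of \<open>r \<times> r\<close> matrices.\<close>

definition povm :: "nat \<Rightarrow> real set \<Rightarrow> (real \<Rightarrow> real mat) \<Rightarrow> bool" where
  "povm r \<Theta> E \<longleftrightarrow> finite \<Theta> \<and> (\<forall>\<theta>\<in>\<Theta>. psd r (E \<theta>)) \<and>
     finsum (module_mat TYPE(real) r r) E \<Theta> = 1\<^sub>m r"

definition outcome_prob :: "(real \<Rightarrow> real mat) \<Rightarrow> real mat \<Rightarrow> real \<Rightarrow> real" where
  "outcome_prob E \<rho> \<theta> = mat_trace (E \<theta> * \<rho>)"

definition expected_outcome :: "real set \<Rightarrow> (real \<Rightarrow> real mat) \<Rightarrow> real mat \<Rightarrow> real" where
  "expected_outcome \<Theta> E \<rho> = (\<Sum>\<theta>\<in>\<Theta>. \<theta> * outcome_prob E \<rho> \<theta>)"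

definition one_way_protocol ::
    "nat \<Rightarrow> nat \<Rightarrow> nat \<Rightarrow> (nat \<Rightarrow> real mat) \<Rightarrow> (nat \<Rightarrow> real set) \<Rightarrow> (nat \<Rightarrow> real \<Rightarrow> real mat) \<Rightarrow> bool"
  where
  "one_way_protocol m n r \<rho> \<Theta> E \<longleftrightarrow>
     (\<forall>i<m. quantum_state r (\<rho> i)) \<and>
     (\<forall>j<n. povm r (\<Theta> j) (E j) \<and> (\<forall>\<theta>\<in>\<Theta> j. \<theta> \<ge> 0))"

definition computes_in_expectation ::
    "nat \<Rightarrow> nat \<Rightarrow> real mat \<Rightarrow> (nat \<Rightarrow> real mat) \<Rightarrow> (nat \<Rightarrow> real set) \<Rightarrow> (nat \<Rightarrow> real \<Rightarrow> real mat) \<Rightarrow> bool"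
  where
  "computes_in_expectation m n M \<rho> \<Theta> E \<longleftrightarrow>
     (\<forall>i<m. \<forall>j<n. expected_outcome (\<Theta> j) (E j) (\<rho> i) = M $$ (i, j))"

end

theory Submission
  imports Defs
begin

text \<open>An expected outcome is the trace of \<open>(\<Sum>\<theta>. \<theta> E\<^sub>\<theta>) \<rho>\<close>, and \<open>\<Sum>\<theta>. \<theta> E\<^sub>\<theta>\<close> is PSD for
  nonnegative labels, which gives (i). For (ii), the factors \<open>T\<^sub>i\<close> need not have equal traces:
  choose \<open>c\<close> at least as large as all these traces and fill up \<open>T\<^sub>i / c\<close> to a state with one
  extra diagonal entry. Bob measures with the labels \<open>0\<close> and \<open>L\<close>, where \<open>L\<close> is so large that
  \<open>L I - c U\<^sub>j\<close> is PSD; the element for \<open>L\<close> is \<open>c U\<^sub>j / L\<close>, extended by \<open>0\<close> so that it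
  ignores the extra entry.\<close>

section \<open>Positivity and traces in terms of entries\<close>

lemma quadratic_form_eq_sum:
  fixes A :: "real mat"
  assumes "A \<in> carrier_mat r r" "x \<in> carrier_vec r"
  shows "x \<bullet> (A *\<^sub>v x) = (\<Sum>i<r. \<Sum>j<r. x $ i * A $$ (i, j) * x $ j)"
  using assms
  by (simp add: scalar_prod_def mult_mat_vec_def sum_distrib_left atLeast0LessThan mult.assoc)

text \<open>Every function \<open>f\<close> yields a test vector \<open>vec r f\<close>, and only
  its values below \<open>r\<close> count. Positivity thus becomes a statement about finite double
  sums, free of vectors and their carriers.\<close>

lemma psd_iff_entries:
  "psd r A \<longleftrightarrow> A \<in> carrier_mat r r \<and> (\<forall>i<r. \<forall>j<r. A $$ (i, j) = A $$ (j, i)) \<and>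
     (\<forall>f. 0 \<le> (\<Sum>i<r. \<Sum>j<r. f i * A $$ (i, j) * f j))" (is "?L \<longleftrightarrow> ?R")
proof
  assume L: ?L
  then have A: "A \<in> carrier_mat r r" by (simp add: psd_def)
  have "A $$ (i, j) = A $$ (j, i)" if "i < r" "j < r" for i j
  proof -
    have "transpose_mat A $$ (i, j) = A $$ (j, i)" using A that by simp
    then show ?thesis using L by (simp add: psd_def)
  qed
  moreover have "0 \<le> (\<Sum>i<r. \<Sum>j<r. f i * A $$ (i, j) * f j)" for f
  proof -
    have "0 \<le> vec r f \<bullet> (A *\<^sub>v vec r f)" using L by (simp add: psd_def)
    then show ?thesis by (simp add: quadratic_form_eq_sum[OF A])
  qed
  ultimately show ?R using A by blast
next
  assume R: ?R
  then have A: "A \<in> carrier_mat r r" by blast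
  have "transpose_mat A = A" using R A by (intro eq_matI) auto
  then show ?L using R A by (simp add: psd_def quadratic_form_eq_sum[OF A])
qed

lemma psd_quadratic_form_nonneg:
  "psd r A \<Longrightarrow> 0 \<le> (\<Sum>i<r. \<Sum>j<r. f i * A $$ (i, j) * f j)"
  by (simp add: psd_iff_entries)

lemma mat_trace_mult:
  assumes "A \<in> carrier_mat r r" "B \<in> carrier_mat r r"
  shows "mat_trace (A * B) = (\<Sum>i<r. \<Sum>j<r. A $$ (i, j) * B $$ (j, i))"
  using assms by (simp add: mat_trace_def scalar_prod_def atLeast0LessThan)

lemma mat_trace_mult_commute:
  assumes "A \<in> carrier_mat r r" "B \<in> carrier_mat r r"
  shows "mat_trace (A * B) = mat_trace (B * A)"
  unfolding mat_trace_mult[OF assms] mat_trace_mult[OF assms(2,1)]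
  by (subst sum.swap) (simp add: mult.commute)

lemma mat_trace_smult:
  assumes "A \<in> carrier_mat r r"
  shows "mat_trace (a \<cdot>\<^sub>m A) = a * mat_trace A"
  using assms by (simp add: mat_trace_def sum_distrib_left)

lemma psd_carrier: "psd r A \<Longrightarrow> A \<in> carrier_mat r r"
  by (simp add: psd_def)

lemma psd_trace_nonneg:
  assumes "psd r A"
  shows "0 \<le> mat_trace A"
proof -
  have "0 \<le> A $$ (k, k)" if "k < r" for k
  proof -
    \<comment> \<open>Testing the form on the unit vector with index \<open>k\<close> isolates one
      diagonal entry.\<close>
    have "0 \<le> (\<Sum>i<r. \<Sum>j<r. of_bool (i = k) * A $$ (i, j) * of_bool (j = k))"
      using assms by (rule psd_quadratic_form_nonneg)
    also have "\<dots> = (\<Sum>i<r. if i = k then \<Sum>j<r. if j = k then A $$ (i, j) else 0 else 0)"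
      by (intro sum.cong) (auto intro!: sum.cong)
    finally show ?thesis using that by simp
  qed
  then show ?thesis
    using psd_carrier[OF assms] by (auto simp: mat_trace_def intro!: sum_nonneg)
qed

lemma psd_smult:
  assumes "psd r A" "0 \<le> a"
  shows "psd r (a \<cdot>\<^sub>m A)"
  unfolding psd_iff_entries
proof (intro conjI allI impI)
  note A = psd_carrier[OF assms(1)]
  show "a \<cdot>\<^sub>m A \<in> carrier_mat r r" using A by simp
  show "(a \<cdot>\<^sub>m A) $$ (i, j) = (a \<cdot>\<^sub>m A) $$ (j, i)" if "i < r" "j < r" for i j
    using assms A that by (auto simp: psd_iff_entries)
  fix f
  have "(\<Sum>i<r. \<Sum>j<r. f i * (a \<cdot>\<^sub>m A) $$ (i, j) * f j) = a * (\<Sum>i<r. \<Sum>j<r. f i * A $$ (i, j) * f j)"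
    using A by (simp add: sum_distrib_left mult_ac)
  then show "0 \<le> (\<Sum>i<r. \<Sum>j<r. f i * (a \<cdot>\<^sub>m A) $$ (i, j) * f j)"
    using assms by (simp add: psd_iff_entries)
qed

section \<open>From a POVM to a single PSD matrix\<close>

definition weighted_sum_mat :: "nat \<Rightarrow> real set \<Rightarrow> (real \<Rightarrow> real mat) \<Rightarrow> real mat" where
  "weighted_sum_mat r \<Theta> E = mat r r (\<lambda>(i, j). \<Sum>\<theta>\<in>\<Theta>. \<theta> * E \<theta> $$ (i, j))"

text \<open>The quadratic form is the combination of the forms of the \<open>E \<theta>\<close> with
  the labels as coefficients, which is where the sign of the labels enters.\<close>

lemma psd_weighted_sum_mat:
  assumes "\<And>\<theta>. \<theta> \<in> \<Theta> \<Longrightarrow> psd r (E \<theta>)" "\<And>\<theta>. \<theta> \<in> \<Theta> \<Longrightarrow> 0 \<le> \<theta>"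
  shows "psd r (weighted_sum_mat r \<Theta> E)"
  unfolding psd_iff_entries
proof (intro conjI allI impI)
  let ?W = "weighted_sum_mat r \<Theta> E"
  show "?W \<in> carrier_mat r r" by (simp add: weighted_sum_mat_def)
  show "?W $$ (i, j) = ?W $$ (j, i)" if "i < r" "j < r" for i j
    using assms(1) that by (auto simp: weighted_sum_mat_def psd_iff_entries intro!: sum.cong)
  fix f
  have "(\<Sum>i<r. \<Sum>j<r. f i * ?W $$ (i, j) * f j)
      = (\<Sum>i<r. \<Sum>j<r. \<Sum>\<theta>\<in>\<Theta>. \<theta> * (f i * E \<theta> $$ (i, j) * f j))"
    by (simp add: weighted_sum_mat_def sum_distrib_left sum_distrib_right mult_ac)
  also have "\<dots> = (\<Sum>i<r. \<Sum>\<theta>\<in>\<Theta>. \<Sum>j<r. \<theta> * (f i * E \<theta> $$ (i, j) * f j))"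
    by (intro sum.cong refl sum.swap)
  also have "\<dots> = (\<Sum>\<theta>\<in>\<Theta>. \<theta> * (\<Sum>i<r. \<Sum>j<r. f i * E \<theta> $$ (i, j) * f j))"
    by (subst sum.swap) (simp add: sum_distrib_left)
  also have "\<dots> \<ge> 0"
    by (rule sum_nonneg) (rule mult_nonneg_nonneg[OF assms(2) psd_quadratic_form_nonneg[OF assms(1)]])
  finally show "0 \<le> (\<Sum>i<r. \<Sum>j<r. f i * ?W $$ (i, j) * f j)" .
qed

text \<open>Linearity of the trace in its first factor: the sum over labels moves inside, past both
  index sums.\<close>

lemma expected_outcome_eq_trace:
  assumes "\<And>\<theta>. \<theta> \<in> \<Theta> \<Longrightarrow> E \<theta> \<in> carrier_mat r r" "\<rho> \<in> carrier_mat r r"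
  shows "expected_outcome \<Theta> E \<rho> = mat_trace (weighted_sum_mat r \<Theta> E * \<rho>)"
proof -
  have W: "weighted_sum_mat r \<Theta> E \<in> carrier_mat r r" by (simp add: weighted_sum_mat_def)
  have "expected_outcome \<Theta> E \<rho> = (\<Sum>\<theta>\<in>\<Theta>. \<Sum>i<r. \<Sum>j<r. \<theta> * E \<theta> $$ (i, j) * \<rho> $$ (j, i))"
    using assms
    by (simp add: expected_outcome_def outcome_prob_def mat_trace_mult[of _ r] sum_distrib_left mult_ac)
  also have "\<dots> = (\<Sum>i<r. \<Sum>\<theta>\<in>\<Theta>. \<Sum>j<r. \<theta> * E \<theta> $$ (i, j) * \<rho> $$ (j, i))"
    by (rule sum.swap)
  also have "\<dots> = (\<Sum>i<r. \<Sum>j<r. \<Sum>\<theta>\<in>\<Theta>. \<theta> * E \<theta> $$ (i, j) * \<rho> $$ (j, i))"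
    by (intro sum.cong refl sum.swap)
  also have "\<dots> = mat_trace (weighted_sum_mat r \<Theta> E * \<rho>)"
    unfolding mat_trace_mult[OF W assms(2)] by (simp add: weighted_sum_mat_def sum_distrib_right)
  finally show ?thesis .
qed

section \<open>Bounding a quadratic form by the squared norm\<close>

lemma quadratic_form_le:
  fixes A :: "real mat"
  shows "(\<Sum>i<r. \<Sum>j<r. f i * A $$ (i, j) * f j)
    \<le> (\<Sum>i<r. \<Sum>j<r. \<bar>A $$ (i, j)\<bar>) * (\<Sum>k<r. (f k)\<^sup>2)"
proof -
  have "f i * A $$ (i, j) * f j \<le> \<bar>A $$ (i, j)\<bar> * (\<Sum>k<r. (f k)\<^sup>2)" if "i < r" "j < r" for i j
  proof -
    have le: "(f k)\<^sup>2 \<le> (\<Sum>k<r. (f k)\<^sup>2)" if "k < r" for k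
      using that by (intro member_le_sum) auto
    \<comment> \<open>The right side is at most twice the sum of all squares, also when
      \<open>i = j\<close>, so the single product is at most that sum. This crude estimate replaces
      an argument by eigenvalues.\<close>
    have "2 * \<bar>f i\<bar> * \<bar>f j\<bar> \<le> \<bar>f i\<bar>\<^sup>2 + \<bar>f j\<bar>\<^sup>2" by (rule sum_squares_bound)
    then have "\<bar>f i * f j\<bar> \<le> (\<Sum>k<r. (f k)\<^sup>2)"
      using le[OF that(1)] le[OF that(2)] by (simp add: abs_mult)
    then have "\<bar>A $$ (i, j)\<bar> * \<bar>f i * f j\<bar> \<le> \<bar>A $$ (i, j)\<bar> * (\<Sum>k<r. (f k)\<^sup>2)"
      by (rule mult_left_mono) simp
    moreover have "f i * A $$ (i, j) * f j \<le> \<bar>A $$ (i, j)\<bar> * \<bar>f i * f j\<bar>"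
      using abs_ge_self[of "f i * A $$ (i, j) * f j"] by (simp add: abs_mult mult_ac)
    ultimately show ?thesis by linarith
  qed
  then show ?thesis
    unfolding sum_distrib_right by (intro sum_mono) auto
qed

text \<open>Makes \<open>(1 / L) \<cdot>\<^sub>m A\<close> admissible as a POVM element, with the
  difference as its partner.\<close>

lemma psd_one_minus_smult:
  assumes "psd r A"
  obtains L where "0 < L" "psd r (1\<^sub>m r - (1 / L) \<cdot>\<^sub>m A)"
proof
  \<comment> \<open>The sum is the bound from \<open>quadratic_form_le\<close>; adding 1 keeps the
    divisor positive even for the zero matrix.\<close>
  let ?L = "1 + (\<Sum>i<r. \<Sum>j<r. \<bar>A $$ (i, j)\<bar>)"
  let ?B = "1\<^sub>m r - (1 / ?L) \<cdot>\<^sub>m A"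
  note A = psd_carrier[OF assms]
  have "0 \<le> (\<Sum>i<r. \<Sum>j<r. \<bar>A $$ (i, j)\<bar>)" by (intro sum_nonneg) auto
  then show pos: "0 < ?L" by linarith
  show "psd r ?B"
    unfolding psd_iff_entries
  proof (intro conjI allI impI)
    show "?B \<in> carrier_mat r r" using A by (intro minus_carrier_mat smult_carrier_mat)
    show "?B $$ (i, j) = ?B $$ (j, i)" if "i < r" "j < r" for i j
      using assms A that by (auto simp: psd_iff_entries)
    fix f
    let ?q = "\<Sum>i<r. \<Sum>j<r. f i * A $$ (i, j) * f j"
    have "(\<Sum>i<r. \<Sum>j<r. f i * ?B $$ (i, j) * f j)
        = (\<Sum>i<r. \<Sum>j<r. (if i = j then f i * f j else 0) - (1 / ?L) * (f i * A $$ (i, j) * f j))"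
      using A by (intro sum.cong refl) (auto simp: algebra_simps)
    also have "\<dots> = (\<Sum>k<r. (f k)\<^sup>2) - (1 / ?L) * ?q"
      by (simp add: sum_subtractf sum_distrib_left power2_eq_square)
    finally have eq: "(\<Sum>i<r. \<Sum>j<r. f i * ?B $$ (i, j) * f j) = (\<Sum>k<r. (f k)\<^sup>2) - (1 / ?L) * ?q" .
    have "?q \<le> ?L * (\<Sum>k<r. (f k)\<^sup>2)"
      using quadratic_form_le[of f A r] sum_nonneg[of "{..<r}" "\<lambda>k. (f k)\<^sup>2"]
      by (simp add: distrib_right)
    then have "(1 / ?L) * ?q \<le> (\<Sum>k<r. (f k)\<^sup>2)"
      using pos by (simp add: pos_divide_le_eq mult.commute)
    then show "0 \<le> (\<Sum>i<r. \<Sum>j<r. f i * ?B $$ (i, j) * f j)" using eq by linarith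
  qed
qed

section \<open>Block-diagonal extension by one dimension\<close>

definition extend_diag :: "nat \<Rightarrow> real mat \<Rightarrow> real \<Rightarrow> real mat" where
  "extend_diag r A d = mat (r + 1) (r + 1)
     (\<lambda>(i, j). if i < r \<and> j < r then A $$ (i, j) else if i = j then d else 0)"

lemma extend_diag_carrier: "extend_diag r A d \<in> carrier_mat (r + 1) (r + 1)"
  by (simp add: extend_diag_def)

lemma mat_trace_extend_diag:
  assumes "A \<in> carrier_mat r r"
  shows "mat_trace (extend_diag r A d) = mat_trace A + d"
  using assms by (simp add: mat_trace_def extend_diag_def)

text \<open>Blocks multiply separately, as the entries outside them vanish. Setting
  \<open>b = 0\<close> makes the extra entry \<open>a\<close> invisible, and vice versa.\<close>

lemma mat_trace_extend_diag_mult: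
  assumes "A \<in> carrier_mat r r" "B \<in> carrier_mat r r"
  shows "mat_trace (extend_diag r A a * extend_diag r B b) = mat_trace (A * B) + a * b"
  unfolding mat_trace_mult[OF assms] mat_trace_mult[OF extend_diag_carrier extend_diag_carrier]
  by (simp add: extend_diag_def)

lemma psd_extend_diag:
  assumes "psd r A" "0 \<le> d"
  shows "psd (r + 1) (extend_diag r A d)"
  unfolding psd_iff_entries
proof (intro conjI allI impI)
  let ?X = "extend_diag r A d"
  show "?X \<in> carrier_mat (r + 1) (r + 1)" by (rule extend_diag_carrier)
  show "?X $$ (i, j) = ?X $$ (j, i)" if "i < r + 1" "j < r + 1" for i j
    using assms(1) that by (auto simp: extend_diag_def psd_iff_entries)
  fix f
  \<comment> \<open>The entry \<open>d\<close> sits at \<open>(r, r)\<close> alone, so the new row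
    and column contribute just one term.\<close>
  have "(\<Sum>i<r+1. \<Sum>j<r+1. f i * ?X $$ (i, j) * f j)
      = (\<Sum>i<r. \<Sum>j<r. f i * A $$ (i, j) * f j) + d * (f r)\<^sup>2"
    by (simp add: extend_diag_def power2_eq_square)
  moreover have "0 \<le> (\<Sum>i<r. \<Sum>j<r. f i * A $$ (i, j) * f j)"
    using assms(1) by (simp add: psd_iff_entries)
  ultimately show "0 \<le> (\<Sum>i<r+1. \<Sum>j<r+1. f i * ?X $$ (i, j) * f j)"
    using assms(2) by simp
qed

text \<open>The extra dimension goes entirely to the complement, which will carry the label
  0.\<close>

lemma extend_diag_complement:
  assumes "A \<in> carrier_mat r r"
  shows "extend_diag r (1\<^sub>m r - A) 1 + extend_diag r A 0 = 1\<^sub>m (r + 1)"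
  using assms by (intro eq_matI) (auto simp: extend_diag_def)

lemma povm_two:
  assumes "\<theta> \<noteq> \<theta>'" "psd r (E \<theta>)" "psd r (E \<theta>')" "E \<theta> + E \<theta>' = 1\<^sub>m r"
  shows "povm r {\<theta>, \<theta>'} E"
proof -
  interpret abelian_group "module_mat TYPE(real) r r" by (rule abelian_group_mat)
  have "E \<theta> \<in> carrier_mat r r" "E \<theta>' \<in> carrier_mat r r"
    using assms psd_carrier by auto
  \<comment> \<open>Splitting off both labels needs them distinct and leaves the zero of the module,
    which is \<open>0\<^sub>m r r\<close>.\<close>
  then have "finsum (module_mat TYPE(real) r r) E {\<theta>, \<theta>'} = E \<theta> + (E \<theta>' + 0\<^sub>m r r)"
    using assms(1) by (simp add: Pi_def module_mat_simps)
  also have "\<dots> = 1\<^sub>m r" using \<open>E \<theta>' \<in> carrier_mat r r\<close> assms(4) by simp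
  finally show ?thesis using assms(2,3) by (simp add: povm_def)
qed

section \<open>The two directions between protocols and factorizations\<close>

lemma psd_factorization_of_protocol:
  assumes "one_way_protocol m n r \<rho> \<Theta> E" "computes_in_expectation m n M \<rho> \<Theta> E"
  shows "psd_factorization m n r M \<rho> (\<lambda>j. weighted_sum_mat r (\<Theta> j) (E j))"
  unfolding psd_factorization_def
proof (intro conjI allI impI)
  show \<rho>: "psd r (\<rho> i)" if "i < m" for i
    using assms(1) that by (simp add: one_way_protocol_def quantum_state_def)
  have E: "psd r (E j \<theta>)" "0 \<le> \<theta>" if "j < n" "\<theta> \<in> \<Theta> j" for j \<theta>
    using assms(1) that by (auto simp: one_way_protocol_def povm_def)
  show U: "psd r (weighted_sum_mat r (\<Theta> j) (E j))" if "j < n" for j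
    using E[OF that] by (rule psd_weighted_sum_mat)
  show "mat_trace (\<rho> i * weighted_sum_mat r (\<Theta> j) (E j)) = M $$ (i, j)" if "i < m" "j < n" for i j
  proof -
    \<comment> \<open>The state is the second factor in \<open>outcome_prob\<close> but the first in
      the factorization, hence the commutation.\<close>
    have "mat_trace (\<rho> i * weighted_sum_mat r (\<Theta> j) (E j)) = expected_outcome (\<Theta> j) (E j) (\<rho> i)"
      using mat_trace_mult_commute[OF psd_carrier[OF \<rho>] psd_carrier[OF U]]
        expected_outcome_eq_trace[OF psd_carrier[OF E(1)] psd_carrier[OF \<rho>]] that
      by simp
    then show ?thesis using assms(2) that by (simp add: computes_in_expectation_def)
  qed
qed

text \<open>Dividing by \<open>c\<close> leaves a trace of at most 1, and the extra entry is exactly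
  the missing amount.\<close>

lemma state_extend_diag:
  assumes "psd r T" "mat_trace T \<le> c" "0 < c"
  shows "quantum_state (r + 1) (extend_diag r ((1 / c) \<cdot>\<^sub>m T) (1 - mat_trace T / c))"
proof -
  have "psd r ((1 / c) \<cdot>\<^sub>m T)" using assms by (intro psd_smult) auto
  then have "psd (r + 1) (extend_diag r ((1 / c) \<cdot>\<^sub>m T) (1 - mat_trace T / c))"
    using assms by (intro psd_extend_diag) auto
  then show ?thesis
    using psd_carrier[OF assms(1)]
    by (simp add: quantum_state_def mat_trace_extend_diag mat_trace_smult[of _ r])
qed

text \<open>The POVM is fixed before \<open>T\<close> and \<open>d\<close>, since Bob does not know
  the input of Alice: one measurement must serve all rows.\<close>

lemma povm_extend_diag:
  assumes "psd r U" "0 < c"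
  obtains \<Theta> E where "povm (r + 1) \<Theta> E" "\<And>\<theta>. \<theta> \<in> \<Theta> \<Longrightarrow> 0 \<le> \<theta>"
    "\<And>T d. T \<in> carrier_mat r r \<Longrightarrow>
       expected_outcome \<Theta> E (extend_diag r ((1 / c) \<cdot>\<^sub>m T) d) = mat_trace (T * U)"
proof -
  have cU: "psd r (c \<cdot>\<^sub>m U)" using assms by (intro psd_smult) auto
  then obtain L where L: "0 < L" "psd r (1\<^sub>m r - (1 / L) \<cdot>\<^sub>m (c \<cdot>\<^sub>m U))"
    by (rule psd_one_minus_smult)
  define B where "B = (1 / L) \<cdot>\<^sub>m (c \<cdot>\<^sub>m U)"
  \<comment> \<open>Only the values at 0 and \<open>L\<close> matter, and these labels differ
    because \<open>L\<close> is positive.\<close>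
  define E where "E \<theta> = (if \<theta> = 0 then extend_diag r (1\<^sub>m r - B) 1 else extend_diag r B 0)" for \<theta> :: real
  have B: "psd r B" unfolding B_def using L(1) by (intro psd_smult[OF cU]) simp
  show ?thesis
  proof
    show "povm (r + 1) {0, L} E"
      using L(1) psd_extend_diag[OF L(2)[folded B_def], of 1] psd_extend_diag[OF B, of 0]
        extend_diag_complement[OF psd_carrier[OF B]]
      by (intro povm_two) (auto simp: E_def)
    show "0 \<le> \<theta>" if "\<theta> \<in> {0, L}" for \<theta>
      using that L(1) by auto
    fix T :: "real mat" and d assume T: "T \<in> carrier_mat r r"
    have U: "U \<in> carrier_mat r r" using assms(1) by (rule psd_carrier)
    \<comment> \<open>Label 0 contributes nothing, and at label \<open>L\<close> the entry
      \<open>d\<close> is multiplied by 0. Afterwards \<open>L\<close> and \<open>c\<close> cancel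
      against the two scalings.\<close>
    have "expected_outcome {0, L} E (extend_diag r ((1 / c) \<cdot>\<^sub>m T) d)
        = L * mat_trace (B * ((1 / c) \<cdot>\<^sub>m T))"
      using L(1) T psd_carrier[OF B]
      by (simp add: expected_outcome_def outcome_prob_def E_def mat_trace_extend_diag_mult)
    also have "\<dots> = mat_trace (U * T)"
      using L(1) assms(2) T U
      by (simp add: B_def mat_trace_mult[of _ r] sum_distrib_left)
    also have "\<dots> = mat_trace (T * U)"
      using U T by (rule mat_trace_mult_commute)
    finally show "expected_outcome {0, L} E (extend_diag r ((1 / c) \<cdot>\<^sub>m T) d) = mat_trace (T * U)" .
  qed
qed

lemma protocol_of_psd_factorization:
  assumes "psd_factorization m n r M T U"
  obtains \<rho> \<Theta> E where "one_way_protocol m n (r + 1) \<rho> \<Theta> E" "computes_in_expectation m n M \<rho> \<Theta> E"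
proof -
  have T: "psd r (T i)" if "i < m" for i
    using assms that by (simp add: psd_factorization_def)
  have U: "psd r (U j)" if "j < n" for j
    using assms that by (simp add: psd_factorization_def)
  \<comment> \<open>A sum of nonnegative traces bounds each of them; the 1 keeps \<open>c\<close>
    positive when all traces vanish or \<open>m = 0\<close>.\<close>
  define c where "c = 1 + (\<Sum>i<m. mat_trace (T i))"
  have "0 \<le> (\<Sum>i<m. mat_trace (T i))"
    by (intro sum_nonneg psd_trace_nonneg[OF T]) simp
  then have c: "0 < c" by (simp add: c_def)
  have Tc: "mat_trace (T i) \<le> c" if "i < m" for i
    using member_le_sum[of i "{..<m}" "\<lambda>i. mat_trace (T i)"] psd_trace_nonneg[OF T] that
    by (simp add: c_def)
  define \<rho> where "\<rho> i = extend_diag r ((1 / c) \<cdot>\<^sub>m T i) (1 - mat_trace (T i) / c)" for i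
  have "\<exists>\<Theta> E. povm (r + 1) \<Theta> E \<and> (\<forall>\<theta>\<in>\<Theta>. 0 \<le> \<theta>) \<and>
      (\<forall>i<m. expected_outcome \<Theta> E (\<rho> i) = mat_trace (T i * U j))" if "j < n" for j
    using povm_extend_diag[OF U[OF that] c] psd_carrier[OF T] unfolding \<rho>_def by metis
  \<comment> \<open>Choice over the columns turns the separate POVMs into functions of
    \<open>j\<close>.\<close>
  then obtain \<Theta> E where "\<And>j. j < n \<Longrightarrow> povm (r + 1) (\<Theta> j) (E j) \<and> (\<forall>\<theta>\<in>\<Theta> j. 0 \<le> \<theta>) \<and>
      (\<forall>i<m. expected_outcome (\<Theta> j) (E j) (\<rho> i) = mat_trace (T i * U j))"
    by metis
  moreover have "quantum_state (r + 1) (\<rho> i)" if "i < m" for i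
    unfolding \<rho>_def using T[OF that] Tc[OF that] c by (rule state_extend_diag)
  ultimately show ?thesis
    using assms that[of \<rho> \<Theta> E]
    by (simp add: one_way_protocol_def computes_in_expectation_def psd_factorization_def)
qed

theorem theorem14:
  fixes m n r :: nat and M :: "real mat"
  assumes "M \<in> carrier_mat m n"
    and "\<forall>i<m. \<forall>j<n. M $$ (i, j) \<ge> 0"
    and "r > 0"
  shows "((\<exists>\<rho> \<Theta> E. one_way_protocol m n r \<rho> \<Theta> E \<and> computes_in_expectation m n M \<rho> \<Theta> E)
            \<longrightarrow> (\<exists>T U. psd_factorization m n r M T U))
       \<and> ((\<exists>T U. psd_factorization m n r M T U)
            \<longrightarrow> (\<exists>\<rho> \<Theta> E. one_way_protocol m n (r + 1) \<rho> \<Theta> E \<and>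
                  computes_in_expectation m n M \<rho> \<Theta> E))"
  by (meson psd_factorization_of_protocol protocol_of_psd_factorization)

end
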